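(* Let $(\check{\mathfrak g},J,\omega)$ be a pseudo-Kähler nilpotent Lie algebra with metric $\check g$. Let $\check D$ be a derivation of $\check{\mathfrak g}$, $\tau=\pm1$, and let $\mathfrak g=\check{\mathfrak g}\oplus\mathrm{Span}\{b,\xi\}$ be a central extension of $\check{\mathfrak g}$ with a metric $g$ of the form $$g(x,y)=\check g(x,y),\quad g(x,b)=0=g(x,\xi),\quad g(\xi,\xi)=1,\quad g(b,b)=\tau,\quad g(b,\xi)=0,\qquad x,y\in\check{\mathfrak g}.$$ Assume furthermore that - $d\xi^\flat=2\omega$, where the right-hand side is implicitly pulled back to $\mathfrak g$; - $db^\flat=\check D\omega$, where the right-hand side is implicitly pulled back to $\mathfrak g$; - $[J,\check D]=0$; - $[\check D^s,\check D^a]=h\check D^s-2(\check D^s)^2$ for some constant $h\in\mathbb R$. Let $\tilde{\mathfrak g}=\mathfrak g\rtimes\mathrm{Span}\{e_0\}$, where $$[e_0,x]=\check Dx\ (x\in\check{\mathfrak g}),\qquad[e_0,b]=hb-2\tau\xi,\qquad[e_0,\xi]=0.$$ Then $\tilde{\mathfrak g}$ has a $\mathfrak z$-standard Sasaki structure $(\phi,\xi,\eta,\tilde g)$ given by $$\tilde g=g+\tau e^0\otimes e^0,\qquad\eta=\xi^\flat,\qquad\phi(x)=J(x)+\tau g(b,x)e_0\ (x\in\mathfrak g),\qquad\phi(e_0)=-b,$$ where $J$ is extended to $\mathfrak g$ by $J(b)=J(\xi)=0$.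
   Context: All structures are left-invariant and are described on a real finite-dimensional Lie algebra; a (pseudo-Riemannian) metric on a Lie algebra is a nondegenerate symmetric bilinear form of arbitrary signature. $x^\flat=g(x,\cdot)$ on $\mathfrak g$ (for $\eta=\xi^\flat$, equivalently $\tilde g(\xi,\cdot)$ on $\tilde{\mathfrak g}$), $d$ is the Chevalley–Eilenberg differential of $\mathfrak g$, $d\alpha(x,y)=-\alpha([x,y])$ for $1$-forms, and the pullback is along the projection $\mathfrak g\to\check{\mathfrak g}$. $e^0$ is the $1$-form with $e^0(e_0)=1$, $e^0|_{\mathfrak g}=0$, and $g$ is extended by zero on $e_0$. Thus for $x,y\in\check{\mathfrak g}$, $[x,y]_{\mathfrak g}=[x,y]_{\check{\mathfrak g}}-\tau\,db^\flat(x,y)b-d\xi^\flat(x,y)\xi$, with $b,\xi$ central in $\mathfrak g$. For an endomorphism $f$, $f^*$ is the metric adjoint, $f^s=\frac12(f+f^* )$, $f^a=\frac12(f-f^* )$ (for $\check D$, with respect to $\check g$); $f$ acts on $2$-forms by $(f\beta)(u,w)=-\beta(fu,w)-\beta(u,fw)$. A pseudo-Kähler structure on a Lie algebra is $(\check g,J,\omega)$ with $\check g$ a pseudo-Riemannian metric, $J$ an integrable complex structure orthogonal for $\check g$, and $\omega=\check g(\cdot,J\,\cdot)$ a closed $2$-form. An almost contact metric structure on a Lie algebra of dimension $2n+1$ is $(\phi,\xi,\eta,\tilde g)$ with $\eta(\xi)=1$, $\eta\circ\phi=0$, $\phi^2=-\mathrm{Id}+\eta\otimes\xi$, $\tilde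 g(\xi,\xi)=1$, $\eta=\tilde g(\xi,\cdot)$, $\tilde g(\phi x,\phi y)=\tilde g(x,y)-\eta(x)\eta(y)$. With $\Phi=\tilde g(\cdot,\phi\,\cdot)$, it is Sasaki if $d\eta=2\Phi$ and $N_\phi+d\eta\otimes\xi=0$ on $\tilde{\mathfrak g}$, where $N_\phi(x,y)=\phi^2[x,y]+[\phi x,\phi y]-\phi[\phi x,y]-\phi[x,\phi y]$. A Sasaki structure on $\tilde{\mathfrak g}$ is $\mathfrak z$-standard if there is an orthogonal decomposition $\tilde{\mathfrak g}=\mathfrak g\rtimes\mathrm{Span}\{e_0\}$ with $\mathfrak g$ a nilpotent ideal, $\tilde g=g+\tau e^0\otimes e^0$, $\tau=\pm1$, and $b=-\phi(e_0)$ in the center of $\mathfrak g$. *)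

theory Defs
  imports "HOL-Analysis.Analysis"
begin

text \<open>
  A Lie algebra is a bracket on a whole type of class \<open>real_vector\<close> that is finite-dimensional as
  a real vector space.  The class \<open>euclidean_space\<close> is avoided because it excludes dimension 0 and
  carries an unrelated inner product.  Subalgebras and ideals are subspaces of that type.
\<close>

definition lie_algebra :: "('a::real_vector \<Rightarrow> 'a \<Rightarrow> 'a) \<Rightarrow> bool" where
  "lie_algebra br \<longleftrightarrow>
     (\<exists>B. finite B \<and> span B = (UNIV :: 'a set)) \<and>
     bilinear br \<and>
     (\<forall>x. br x x = 0) \<and>
     (\<forall>x y z. br x (br y z) + br y (br z x) + br z (br x y) = 0)"

definition derivation :: "('a::real_vector \<Rightarrow> 'a \<Rightarrow> 'a) \<Rightarrow> ('a \<Rightarrow> 'a) \<Rightarrow> bool" where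
  "derivation br D \<longleftrightarrow> linear D \<and> (\<forall>x y. D (br x y) = br (D x) y + br x (D y))"

definition lie_ideal :: "('a::real_vector \<Rightarrow> 'a \<Rightarrow> 'a) \<Rightarrow> 'a set \<Rightarrow> bool" where
  "lie_ideal br S \<longleftrightarrow> subspace S \<and> (\<forall>x. \<forall>y\<in>S. br x y \<in> S)"

definition lie_center :: "('a::real_vector \<Rightarrow> 'a \<Rightarrow> 'a) \<Rightarrow> 'a set \<Rightarrow> 'a set" where
  "lie_center br S = {z \<in> S. \<forall>x\<in>S. br z x = 0}"

fun lower_central :: "('a::real_vector \<Rightarrow> 'a \<Rightarrow> 'a) \<Rightarrow> 'a set \<Rightarrow> nat \<Rightarrow> 'a set" where
  "lower_central br S 0 = S"
| "lower_central br S (Suc k) = span {br x y | x y. x \<in> S \<and> y \<in> lower_central br S k}"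

definition lie_nilpotent :: "('a::real_vector \<Rightarrow> 'a \<Rightarrow> 'a) \<Rightarrow> 'a set \<Rightarrow> bool" where
  "lie_nilpotent br S \<longleftrightarrow> (\<exists>k. lower_central br S k = {0})"

definition central_extension ::
  "('e::real_vector \<Rightarrow> 'e \<Rightarrow> 'e) \<Rightarrow> ('a::real_vector \<Rightarrow> 'a \<Rightarrow> 'a) \<Rightarrow> ('e \<Rightarrow> 'a) \<Rightarrow> bool" where
  "central_extension brE brA p \<longleftrightarrow>
     lie_algebra brE \<and> lie_algebra brA \<and>
     linear p \<and> surj p \<and> (\<forall>u v. p (brE u v) = brA (p u) (p v)) \<and>
     {u. p u = 0} \<subseteq> lie_center brE UNIV"

text \<open>\<open>(x, r)\<close> stands for \<open>x + r e\<^sub>0\<close>, and \<open>E\<close> for the action \<open>[e\<^sub>0, x] = E x\<close>.\<close>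

definition semidirect_bracket ::
  "('g::real_vector \<Rightarrow> 'g \<Rightarrow> 'g) \<Rightarrow> ('g \<Rightarrow> 'g) \<Rightarrow> 'g \<times> real \<Rightarrow> 'g \<times> real \<Rightarrow> 'g \<times> real" where
  "semidirect_bracket br E u v =
     (br (fst u) (fst v) + snd u *\<^sub>R E (fst v) - snd v *\<^sub>R E (fst u), 0)"

text \<open>Chevalley--Eilenberg differential on 1-forms and 2-forms, normalized without the factors 1/2, 1/3.\<close>

definition ce_d1 :: "('a::real_vector \<Rightarrow> 'a \<Rightarrow> 'a) \<Rightarrow> ('a \<Rightarrow> real) \<Rightarrow> 'a \<Rightarrow> 'a \<Rightarrow> real" where
  "ce_d1 br \<alpha> x y = - \<alpha> (br x y)"

definition ce_d2 :: "('a::real_vector \<Rightarrow> 'a \<Rightarrow> 'a) \<Rightarrow> ('a \<Rightarrow> 'a \<Rightarrow> real) \<Rightarrow> 'a \<Rightarrow> 'a \<Rightarrow> 'a \<Rightarrow> real" where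
  "ce_d2 br \<beta> x y z = - \<beta> (br x y) z + \<beta> (br x z) y - \<beta> (br y z) x"

definition act2 :: "('a \<Rightarrow> 'a) \<Rightarrow> ('a \<Rightarrow> 'a \<Rightarrow> real) \<Rightarrow> 'a \<Rightarrow> 'a \<Rightarrow> real" where
  "act2 f \<beta> u w = - \<beta> (f u) w - \<beta> u (f w)"

definition pullback2 :: "('e \<Rightarrow> 'a) \<Rightarrow> ('a \<Rightarrow> 'a \<Rightarrow> real) \<Rightarrow> 'e \<Rightarrow> 'e \<Rightarrow> real" where
  "pullback2 p \<beta> u v = \<beta> (p u) (p v)"

definition pseudo_metric :: "('a::real_vector \<Rightarrow> 'a \<Rightarrow> real) \<Rightarrow> bool" where
  "pseudo_metric g \<longleftrightarrow>
     bilinear g \<and> (\<forall>x y. g x y = g y x) \<and> (\<forall>x. (\<forall>y. g x y = 0) \<longrightarrow> x = 0)"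

definition flat :: "('a \<Rightarrow> 'a \<Rightarrow> real) \<Rightarrow> 'a \<Rightarrow> 'a \<Rightarrow> real" where
  "flat g x = g x"

text \<open>
  The description is proper when \<open>g\<close> is a metric on a finite-dimensional space and \<open>f\<close> is linear:
  nondegeneracy gives uniqueness, and finite dimension gives existence.
\<close>

definition metric_adjoint :: "('a::real_vector \<Rightarrow> 'a \<Rightarrow> real) \<Rightarrow> ('a \<Rightarrow> 'a) \<Rightarrow> 'a \<Rightarrow> 'a" where
  "metric_adjoint g f = (THE f'. \<forall>x y. g (f' x) y = g x (f y))"

definition sym_part :: "('a::real_vector \<Rightarrow> 'a \<Rightarrow> real) \<Rightarrow> ('a \<Rightarrow> 'a) \<Rightarrow> 'a \<Rightarrow> 'a" where
  "sym_part g f x = (1/2) *\<^sub>R (f x + metric_adjoint g f x)"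

definition skew_part :: "('a::real_vector \<Rightarrow> 'a \<Rightarrow> real) \<Rightarrow> ('a \<Rightarrow> 'a) \<Rightarrow> 'a \<Rightarrow> 'a" where
  "skew_part g f x = (1/2) *\<^sub>R (f x - metric_adjoint g f x)"

definition commutator :: "('a::real_vector \<Rightarrow> 'a) \<Rightarrow> ('a \<Rightarrow> 'a) \<Rightarrow> 'a \<Rightarrow> 'a" where
  "commutator f f' x = f (f' x) - f' (f x)"

definition nijenhuis :: "('a::real_vector \<Rightarrow> 'a \<Rightarrow> 'a) \<Rightarrow> ('a \<Rightarrow> 'a) \<Rightarrow> 'a \<Rightarrow> 'a \<Rightarrow> 'a" where
  "nijenhuis br f x y = f (f (br x y)) + br (f x) (f y) - f (br (f x) y) - f (br x (f y))"

definition pseudo_kaehler ::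
  "('a::real_vector \<Rightarrow> 'a \<Rightarrow> 'a) \<Rightarrow> ('a \<Rightarrow> 'a \<Rightarrow> real) \<Rightarrow> ('a \<Rightarrow> 'a) \<Rightarrow> ('a \<Rightarrow> 'a \<Rightarrow> real) \<Rightarrow> bool" where
  "pseudo_kaehler br g J \<omega> \<longleftrightarrow>
     lie_algebra br \<and> pseudo_metric g \<and>
     linear J \<and> (\<forall>x. J (J x) = - x) \<and> (\<forall>x y. nijenhuis br J x y = 0) \<and>
     (\<forall>x y. g (J x) (J y) = g x y) \<and>
     (\<forall>x y. \<omega> x y = g x (J y)) \<and>
     (\<forall>x y z. ce_d2 br \<omega> x y z = 0)"

definition almost_contact_metric ::
  "('a::real_vector \<Rightarrow> 'a) \<Rightarrow> 'a \<Rightarrow> ('a \<Rightarrow> real) \<Rightarrow> ('a \<Rightarrow> 'a \<Rightarrow> real) \<Rightarrow> bool" where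
  "almost_contact_metric \<phi> \<xi> \<eta> g \<longleftrightarrow>
     (\<exists>n. dim (UNIV :: 'a set) = 2 * n + 1) \<and>
     linear \<phi> \<and> linear \<eta> \<and> pseudo_metric g \<and>
     \<eta> \<xi> = 1 \<and>
     (\<forall>x. \<eta> (\<phi> x) = 0) \<and>
     (\<forall>x. \<phi> (\<phi> x) = - x + \<eta> x *\<^sub>R \<xi>) \<and>
     g \<xi> \<xi> = 1 \<and>
     (\<forall>x. \<eta> x = g \<xi> x) \<and>
     (\<forall>x y. g (\<phi> x) (\<phi> y) = g x y - \<eta> x * \<eta> y)"

definition sasaki ::
  "('a::real_vector \<Rightarrow> 'a \<Rightarrow> 'a) \<Rightarrow> ('a \<Rightarrow> 'a) \<Rightarrow> 'a \<Rightarrow> ('a \<Rightarrow> real) \<Rightarrow> ('a \<Rightarrow> 'a \<Rightarrow> real) \<Rightarrow> bool" where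
  "sasaki br \<phi> \<xi> \<eta> g \<longleftrightarrow>
     lie_algebra br \<and> almost_contact_metric \<phi> \<xi> \<eta> g \<and>
     (\<forall>x y. ce_d1 br \<eta> x y = 2 * g x (\<phi> y)) \<and>
     (\<forall>x y. nijenhuis br \<phi> x y + ce_d1 br \<eta> x y *\<^sub>R \<xi> = 0)"

text \<open>
  The conditions on \<open>g\<close> say that \<open>S\<close> and \<open>e\<^sub>0\<close> are orthogonal and that the metric is
  \<open>g|\<^sub>S + \<tau> e\<^sup>0 \<otimes> e\<^sup>0\<close>.
\<close>

definition z_standard_decomposition ::
  "('a::real_vector \<Rightarrow> 'a \<Rightarrow> 'a) \<Rightarrow> ('a \<Rightarrow> 'a) \<Rightarrow> ('a \<Rightarrow> 'a \<Rightarrow> real) \<Rightarrow> 'a set \<Rightarrow> 'a \<Rightarrow> real \<Rightarrow> bool" where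
  "z_standard_decomposition br \<phi> g S e0 \<tau> \<longleftrightarrow>
     lie_ideal br S \<and> lie_nilpotent br S \<and>
     e0 \<notin> S \<and> (\<forall>u. \<exists>x\<in>S. \<exists>r. u = x + r *\<^sub>R e0) \<and>
     (\<tau> = 1 \<or> \<tau> = -1) \<and>
     (\<forall>x\<in>S. g x e0 = 0) \<and> g e0 e0 = \<tau> \<and>
     - \<phi> e0 \<in> lie_center br S"

definition z_standard_sasaki ::
  "('a::real_vector \<Rightarrow> 'a \<Rightarrow> 'a) \<Rightarrow> ('a \<Rightarrow> 'a) \<Rightarrow> 'a \<Rightarrow> ('a \<Rightarrow> real) \<Rightarrow> ('a \<Rightarrow> 'a \<Rightarrow> real) \<Rightarrow> bool" where
  "z_standard_sasaki br \<phi> \<xi> \<eta> g \<longleftrightarrow>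
     sasaki br \<phi> \<xi> \<eta> g \<and> (\<exists>S e0 \<tau>. z_standard_decomposition br \<phi> g S e0 \<tau>)"

text \<open>
  The direct sum of a vector space \<open>'a\<close> with \<open>Span{b, \<xi>}\<close> is \<open>'a \<times> real \<times> real\<close>, where
  \<open>(x, s, t)\<close> stands for \<open>x + s b + t \<xi>\<close>; adding \<open>Span{e\<^sub>0}\<close> gives
  \<open>('a \<times> real \<times> real) \<times> real\<close>.
\<close>

type_synonym 'a ext = "'a \<times> real \<times> real"

definition base :: "'a \<Rightarrow> 'a ext" where "base x = (x, 0, 0)"

definition b_vec :: "('a::real_vector) ext" where "b_vec = (0, 1, 0)"

definition xi_vec :: "('a::real_vector) ext" where "xi_vec = (0, 0, 1)"

definition e0_vec :: "('a::real_vector) ext \<times> real" where "e0_vec = (0, 1)"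

definition in_tilde :: "('a::real_vector) ext \<Rightarrow> 'a ext \<times> real" where "in_tilde x = (x, 0)"

definition e0_action :: "('a::real_vector \<Rightarrow> 'a) \<Rightarrow> real \<Rightarrow> real \<Rightarrow> 'a ext \<Rightarrow> 'a ext" where
  "e0_action D h \<tau> = (\<lambda>(x, s, t). base (D x) + s *\<^sub>R (h *\<^sub>R b_vec - (2 * \<tau>) *\<^sub>R xi_vec))"

definition J_ext :: "('a::real_vector \<Rightarrow> 'a) \<Rightarrow> 'a ext \<Rightarrow> 'a ext" where
  "J_ext J = (\<lambda>(x, s, t). base (J x))"

definition metric_tilde ::
  "('a::real_vector ext \<Rightarrow> 'a ext \<Rightarrow> real) \<Rightarrow> real \<Rightarrow> 'a ext \<times> real \<Rightarrow> 'a ext \<times> real \<Rightarrow> real" where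
  "metric_tilde g \<tau> u v = g (fst u) (fst v) + \<tau> * (snd u * snd v)"

definition phi_tilde ::
  "('a::real_vector \<Rightarrow> 'a) \<Rightarrow> ('a ext \<Rightarrow> 'a ext \<Rightarrow> real) \<Rightarrow> real \<Rightarrow> 'a ext \<times> real \<Rightarrow> 'a ext \<times> real" where
  "phi_tilde J g \<tau> = (\<lambda>(x, r).
     in_tilde (J_ext J x) + (\<tau> * g b_vec x) *\<^sub>R e0_vec - r *\<^sub>R in_tilde b_vec)"

end

theory Submission
  imports Defs
begin

text \<open>
  In the coordinates \<open>x + s b + t \<xi> + r e\<^sub>0\<close> every object has an explicit formula.  The metric is
  \<open>gc x y + \<tau> s s' + t t' + \<tau> r r'\<close>.  The hypotheses on \<open>db\<close> and \<open>d\<xi>\<close> say that the bracket of the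
  central extension has the component \<open>\<tau> (\<omega>(D x, y) + \<omega>(x, D y))\<close> along \<open>b\<close> and \<open>-2 \<omega>(x, y)\<close> along
  \<open>\<xi>\<close> (\<open>bracket_ext_coords\<close>), and \<open>\<phi>\<close> sends \<open>(x, s, t, r)\<close> to \<open>(J x, - r, 0, s)\<close>: it is \<open>J\<close> on the
  base and a rotation of the plane spanned by \<open>b\<close> and \<open>e\<^sub>0\<close>.  Compatibility of \<open>\<phi>\<close> with the metric,
  \<open>d\<eta> = 2 \<Phi>\<close>, and normality are then read off from \<open>J\<close> being orthogonal, integrable and commuting
  with \<open>D\<close> (\<open>almost_contact_metric_tilde\<close>, \<open>contact_form_tilde\<close>, \<open>normal_tilde\<close>).

  The hypothesis on the symmetric and skew parts of \<open>D\<close> is what makes the semidirect product a Lie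
  algebra.  The action of \<open>e\<^sub>0\<close> must be a derivation of the extension, and its Leibniz rule along \<open>b\<close>
  says that letting \<open>D\<close> act twice on \<open>\<omega>\<close> gives \<open>-h\<close> times letting it act once.  Since \<open>D\<close> commutes
  with \<open>J\<close>, moving all occurrences of \<open>D\<close> to the first argument turns this into
  \<open>h (D + D\<^sup>*) = D\<^sup>2 + 2 D\<^sup>* D + (D\<^sup>*)\<^sup>2\<close>, which is \<open>[D\<^sup>s, D\<^sup>a] = h D\<^sup>s - 2 (D\<^sup>s)\<^sup>2\<close> written out
  (\<open>sym_skew_condition_expanded\<close>, \<open>twice_derived_kaehler_form\<close>).

  Two points are not computations.  The adjoint of \<open>D\<close> exists because a nondegenerate form on a
  finite-dimensional space represents all functionals, and the total dimension is odd because \<open>\<phi>\<close> is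
  a complex structure on the kernel of \<open>\<eta>\<close>.
\<close>

section \<open>Linear algebra\<close>

text \<open>
  Pairing with a basis \<open>B\<close> turns \<open>g\<close> into the endomorphism \<open>x \<mapsto> \<Sum>b\<in>B. g x b b\<close>.  Nondegeneracy
  makes it injective, hence surjective in finite dimension, which is the duality claimed here.
\<close>

lemma pseudo_metric_represents_functionals:
  fixes g :: "'a::real_vector \<Rightarrow> 'a \<Rightarrow> real"
  assumes fin: "\<exists>B. finite B \<and> span B = (UNIV :: 'a set)"
    and g: "pseudo_metric g" and \<alpha>: "linear \<alpha>"
  shows "\<exists>x. \<forall>y. g x y = \<alpha> y"
proof -
  have bil: "bilinear g" using g by (simp add: pseudo_metric_def)
  obtain B where B: "finite B" "independent B" "span B = (UNIV :: 'a set)"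
  proof -
    obtain A where A: "finite A" "span A = (UNIV :: 'a set)" using fin by blast
    obtain C where C: "independent C" "UNIV \<subseteq> span (C :: 'a set)"
      by (rule maximal_independent_subset[of UNIV])
    have "finite C" using independent_span_bound[OF A(1) C(1)] A(2) by simp
    then show thesis using C by (intro that) auto
  qed
  interpret fd: finite_dimensional_vector_space "scaleR :: real \<Rightarrow> 'a \<Rightarrow> 'a" B
    using B by unfold_locales (simp_all add: dependent_raw_def span_raw_def)
  define G where "G x = (\<Sum>b\<in>B. g x b *\<^sub>R b)" for x
  have lin: "linear G"
    unfolding G_def
    by (rule linearI)
      (simp_all add: bilinear_ladd[OF bil] bilinear_lmul[OF bil] scaleR_left_distrib
        sum.distrib scaleR_sum_right)
  have coeff: "c b = d b"
    if "(\<Sum>b\<in>B. c b *\<^sub>R b) = (\<Sum>b\<in>B. d b *\<^sub>R b)" "b \<in> B" for c d :: "'a \<Rightarrow> real" and b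
  proof -
    have "(\<Sum>b\<in>B. (c b - d b) *\<^sub>R b) = 0"
      using that(1) by (simp add: scaleR_left_diff_distrib sum_subtractf)
    from independentD[OF B(2,1) subset_refl this that(2)] show ?thesis by simp
  qed
  have determined: "g x y = \<beta> y" if "linear \<beta>" "\<And>b. b \<in> B \<Longrightarrow> g x b = \<beta> b" for x y \<beta>
  proof (rule linear_eq_on[where B = B])
    show "linear (g x)" using bil by (simp add: bilinear_def)
  qed (use that B(3) in auto)
  have "inj G"
  proof (subst linear_injective_0[OF lin], intro allI impI)
    fix x assume "G x = 0"
    then have "(\<Sum>b\<in>B. g x b *\<^sub>R b) = (\<Sum>b\<in>B. 0 *\<^sub>R b)" by (simp add: G_def)
    then have "g x b = 0" if "b \<in> B" for b using coeff[of "g x" "\<lambda>_. 0"] that by auto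
    then have "g x y = 0" for y
      using determined[of "\<lambda>_. 0" x y] by (simp add: linear_iff)
    then show "x = 0" using g by (simp add: pseudo_metric_def)
  qed
  then have "surj G" using fd.linear_inj_imp_surj lin by (simp add: linear_def)
  then obtain x where "G x = (\<Sum>b\<in>B. \<alpha> b *\<^sub>R b)" by (metis surjD)
  then have "g x b = \<alpha> b" if "b \<in> B" for b using coeff[of "g x" \<alpha>] that by (auto simp: G_def)
  then show ?thesis using determined[OF \<alpha>] by blast
qed

lemma pseudo_metric_left_cancel:
  assumes g: "pseudo_metric g" and eq: "\<And>y. g x y = g x' y"
  shows "x = x'"
proof -
  have "bilinear g" using g by (simp add: pseudo_metric_def)
  then have "g (x - x') y = 0" for y using eq by (simp add: bilinear_lsub)
  then have "x - x' = 0" using g unfolding pseudo_metric_def by blast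
  then show ?thesis by simp
qed

text \<open>
  Duality provides an adjoint and nondegeneracy makes it unique, so the description that defines it
  denotes.
\<close>

lemma metric_adjoint:
  fixes g :: "'a::real_vector \<Rightarrow> 'a \<Rightarrow> real"
  assumes fin: "\<exists>B. finite B \<and> span B = (UNIV :: 'a set)"
    and g: "pseudo_metric g" and f: "linear f"
  shows "g (metric_adjoint g f x) y = g x (f y)"
proof -
  have bil: "bilinear g" using g by (simp add: pseudo_metric_def)
  have "\<exists>x'. \<forall>y. g x' y = g x (f y)" for x
    by (rule pseudo_metric_represents_functionals[OF fin g])
      (auto simp: linear_iff linear_add[OF f] linear_cmul[OF f] bilinear_radd[OF bil]
        bilinear_rmul[OF bil])
  then obtain f' where f': "\<forall>x y. g (f' x) y = g x (f y)" by metis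
  have "f'' = f'" if "\<forall>x y. g (f'' x) y = g x (f y)" for f''
    by (rule ext, rule pseudo_metric_left_cancel[OF g]) (use that f' in simp)
  then have "\<forall>x y. g (metric_adjoint g f x) y = g x (f y)"
    unfolding metric_adjoint_def
    by (rule theI[where P = "\<lambda>f'. \<forall>x y. g (f' x) y = g x (f y)", OF f'])
  then show ?thesis by blast
qed

lemma linear_metric_adjoint:
  fixes g :: "'a::real_vector \<Rightarrow> 'a \<Rightarrow> real"
  assumes fin: "\<exists>B. finite B \<and> span B = (UNIV :: 'a set)"
    and g: "pseudo_metric g" and f: "linear f"
  shows "linear (metric_adjoint g f)"
proof -
  have bil: "bilinear g" using g by (simp add: pseudo_metric_def)
  show ?thesis
    by (rule linearI; rule pseudo_metric_left_cancel[OF g])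
      (simp_all add: bilinear_ladd[OF bil] bilinear_lmul[OF bil] metric_adjoint[OF fin g f])
qed

text \<open>
  In terms of \<open>D\<close> and its adjoint, the condition \<open>[D\<^sup>s, D\<^sup>a] = h D\<^sup>s - 2 (D\<^sup>s)\<^sup>2\<close> loses its fractions:
  \<open>[D\<^sup>s, D\<^sup>a] = (D\<^sup>* D - D D\<^sup>*) / 2\<close>, and the commutator term turns the two mixed products of
  \<open>(D + D\<^sup>*)\<^sup>2\<close> into twice \<open>D\<^sup>* D\<close>.
\<close>

lemma sym_skew_condition_expanded:
  fixes g :: "'a::real_vector \<Rightarrow> 'a \<Rightarrow> real"
  assumes fin: "\<exists>B. finite B \<and> span B = (UNIV :: 'a set)"
    and g: "pseudo_metric g" and D: "linear D"
    and sym_skew: "commutator (sym_part g D) (skew_part g D)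
      = (\<lambda>x. h *\<^sub>R sym_part g D x - 2 *\<^sub>R sym_part g D (sym_part g D x))"
  defines "D' \<equiv> metric_adjoint g D"
  shows "h *\<^sub>R (D x + D' x) = D (D x) + 2 *\<^sub>R D' (D x) + D' (D' x)"
proof -
  have D': "linear D'" unfolding D'_def by (rule linear_metric_adjoint[OF fin g D])
  note lin = linear_add[OF D] linear_diff[OF D] linear_cmul[OF D]
    linear_add[OF D'] linear_diff[OF D'] linear_cmul[OF D']
  have bil: "bilinear g" using g by (simp add: pseudo_metric_def)
  note blin = bilinear_ladd[OF bil] bilinear_lsub[OF bil] bilinear_lmul[OF bil]
  show ?thesis
  proof (rule pseudo_metric_left_cancel[OF g])
    fix y
    have "g (commutator (sym_part g D) (skew_part g D) x) y
        = g (h *\<^sub>R sym_part g D x - 2 *\<^sub>R sym_part g D (sym_part g D x)) y"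
      by (simp only: sym_skew)
    then have "(g (D' (D x)) y - g (D (D' x)) y) / 2 = h * (g (D x) y + g (D' x) y) / 2
        - (g (D (D x)) y + g (D (D' x)) y + g (D' (D x)) y + g (D' (D' x)) y) / 2"
      unfolding commutator_def sym_part_def skew_part_def D'_def[symmetric] lin blin
      by (simp add: field_simps)
    then show "g (h *\<^sub>R (D x + D' x)) y = g (D (D x) + 2 *\<^sub>R D' (D x) + D' (D' x)) y"
      by (simp add: blin add_divide_distrib)
  qed
qed

text \<open>
  A complex structure on \<open>V\<close> forces even dimension because a basis can be grown by pairs \<open>x, f x\<close>:
  the span of the vectors found so far is \<open>f\<close>-invariant, and modulo an invariant subspace \<open>f\<close> has no
  real eigenvector.
\<close>

lemma even_basis_of_complex_structure:
  fixes f :: "'a::real_vector \<Rightarrow> 'a"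
  assumes f: "linear f" and V: "f ` V \<subseteq> V" "\<And>x. x \<in> V \<Longrightarrow> f (f x) = - x"
    and "finite S" "S \<subseteq> V"
  shows "\<exists>B. B \<subseteq> V \<and> finite B \<and> independent B \<and> even (card B) \<and> f ` B \<subseteq> span B \<and> S \<subseteq> span B"
  using \<open>finite S\<close> \<open>S \<subseteq> V\<close>
proof (induction S rule: finite_induct)
  case empty
  show ?case by (rule exI[of _ "{}"]) (auto simp: independent_empty)
next
  case (insert x S)
  then obtain B where B: "B \<subseteq> V" "finite B" "independent B" "even (card B)"
    "f ` B \<subseteq> span B" "S \<subseteq> span B" by auto
  have x: "x \<in> V" using insert.prems by simp
  have inv: "f w \<in> span B" if "w \<in> span B" for w
  proof -
    have "f w \<in> span (f ` B)" using that by (simp add: linear_span_image[OF f])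
    also have "\<dots> \<subseteq> span B" using B(5) by (simp add: span_minimal)
    finally show ?thesis .
  qed
  show ?case
  proof (cases "x \<in> span B")
    case True
    then show ?thesis using B by auto
  next
    case False
    \<comment> \<open>An eigenvector of \<open>f\<close> modulo \<open>span B\<close> would have the eigenvalue \<open>a\<close> with \<open>a\<^sup>2 = -1\<close>.\<close>
    have new: "f x \<notin> span (insert x B)"
    proof
      assume "f x \<in> span (insert x B)"
      then obtain a where a: "f x - a *\<^sub>R x \<in> span B" by (auto simp: span_breakdown_eq)
      have "- x - a *\<^sub>R f x \<in> span B"
        using inv[OF a] by (simp add: linear_diff[OF f] linear_cmul[OF f] V(2)[OF x])
      then have "(- x - a *\<^sub>R f x) + a *\<^sub>R (f x - a *\<^sub>R x) \<in> span B"
        using a by (intro span_add span_scale)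
      also have "(- x - a *\<^sub>R f x) + a *\<^sub>R (f x - a *\<^sub>R x) = (- (1 + a\<^sup>2)) *\<^sub>R x"
        by (simp add: algebra_simps power2_eq_square)
      finally have "inverse (- (1 + a\<^sup>2)) *\<^sub>R (- (1 + a\<^sup>2)) *\<^sub>R x \<in> span B"
        by (rule span_scale)
      moreover have "1 + a\<^sup>2 \<noteq> 0" by (smt (verit) zero_le_power2)
      then have "inverse (- (1 + a\<^sup>2)) * (- (1 + a\<^sup>2)) = 1" by (intro left_inverse) simp
      ultimately show False using False by simp
    qed
    define B' where "B' = insert (f x) (insert x B)"
    have "x \<notin> B" "f x \<notin> insert x B" using False new by (auto intro: span_base)
    then have "card B' = card B + 2" using B(2) by (simp add: B'_def)
    moreover have "independent B'"
      unfolding B'_def by (intro independent_insertI new False B(3))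
    moreover have mono: "span B \<subseteq> span B'" by (rule span_mono) (auto simp: B'_def)
    moreover have "f ` B' \<subseteq> span B'"
      using B(5) mono V(2)[OF x] by (auto simp: B'_def intro: span_base span_neg)
    moreover have "B' \<subseteq> V" using B(1) x V(1) by (auto simp: B'_def)
    moreover have "x \<in> span B'" by (auto simp: B'_def intro: span_base)
    ultimately show ?thesis using B by (intro exI[of _ B']) (auto simp: B'_def)
  qed
qed

text \<open>The endomorphism \<open>\<phi>\<close> is a complex structure on the kernel of \<open>\<eta>\<close>, a complement of \<open>\<xi>\<close>.\<close>

lemma almost_contact_odd_dimension:
  fixes \<phi> :: "'a::real_vector \<Rightarrow> 'a"
  assumes fin: "\<exists>B. finite B \<and> span B = (UNIV :: 'a set)"
    and \<phi>: "linear \<phi>" and \<eta>: "linear \<eta>" and \<eta>\<xi>: "\<eta> \<xi> = (1::real)"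
    and \<eta>\<phi>: "\<And>x. \<eta> (\<phi> x) = 0" and \<phi>\<phi>: "\<And>x. \<phi> (\<phi> x) = - x + \<eta> x *\<^sub>R \<xi>"
  shows "\<exists>n. dim (UNIV :: 'a set) = 2 * n + 1"
proof -
  obtain A where A: "finite A" "span A = (UNIV :: 'a set)" using fin by blast
  define V where "V = {x. \<eta> x = 0}"
  define \<pi> where "\<pi> x = x - \<eta> x *\<^sub>R \<xi>" for x
  have \<pi>: "linear \<pi>"
    unfolding \<pi>_def
    by (rule linearI) (simp_all add: linear_add[OF \<eta>] linear_cmul[OF \<eta>] algebra_simps)
  have \<pi>V: "\<pi> x \<in> V" for x
    by (simp add: \<pi>_def V_def linear_diff[OF \<eta>] linear_cmul[OF \<eta>] \<eta>\<xi>)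
  have "\<exists>B\<subseteq>V. finite B \<and> independent B \<and> even (card B) \<and> \<phi> ` B \<subseteq> span B \<and> \<pi> ` A \<subseteq> span B"
    by (rule even_basis_of_complex_structure[OF \<phi>]) (use A(1) \<pi>V \<eta>\<phi> \<phi>\<phi> in \<open>auto simp: V_def\<close>)
  then obtain B where B: "B \<subseteq> V" "finite B" "independent B" "even (card B)" "\<pi> ` A \<subseteq> span B"
    by blast
  have "subspace V" unfolding V_def by (rule linear_subspace_kernel[OF \<eta>])
  then have "span B \<subseteq> V" using B(1) by (simp add: span_minimal)
  then have \<xi>B: "\<xi> \<notin> span B" using \<eta>\<xi> by (auto simp: V_def)
  have "y \<in> span (insert \<xi> B)" for y
  proof -
    have "\<pi> y \<in> span (\<pi> ` A)" using A(2) by (simp add: linear_span_image[OF \<pi>])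
    also have "\<dots> \<subseteq> span B" using B(5) by (simp add: span_minimal)
    finally show ?thesis unfolding span_breakdown_eq \<pi>_def by blast
  qed
  then have "dim (UNIV :: 'a set) = card (insert \<xi> B)"
    by (intro dim_eq_card) (use independent_insertI[OF \<xi>B B(3)] in auto)
  moreover have "\<xi> \<notin> B" using \<xi>B span_base by blast
  ultimately have "dim (UNIV :: 'a set) = card B + 1" using B(2) by simp
  then show ?thesis using B(4) by (auto elim: evenE)
qed

section \<open>Semidirect products and central extensions\<close>

lemma finite_span_times_real:
  assumes "\<exists>B. finite B \<and> span B = (UNIV :: 'a::real_vector set)"
  shows "\<exists>B. finite B \<and> span B = (UNIV :: ('a \<times> real) set)"
proof -
  obtain B where B: "finite B" "span B = (UNIV :: 'a set)" using assms by blast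
  let ?C = "insert (0, 1) ((\<lambda>x. (x, 0)) ` B) :: ('a \<times> real) set"
  have "linear (\<lambda>x::'a. (x, 0::real))" by (rule linearI) auto
  then have "range (\<lambda>x::'a. (x, 0::real)) = span ((\<lambda>x. (x, 0)) ` B)"
    using B(2) by (simp add: linear_span_image)
  then have "(x, r) - r *\<^sub>R (0, 1) \<in> span ((\<lambda>x. (x, 0)) ` B)" for x :: 'a and r :: real
    by (auto simp flip: \<open>range _ = _\<close>)
  then have "v \<in> span ?C" for v unfolding span_breakdown_eq by (cases v) blast
  then show ?thesis using B(1) by (intro exI[of _ ?C]) auto
qed

lemma bilinear_semidirect_bracket:
  assumes "bilinear br" "linear E"
  shows "bilinear (semidirect_bracket br E)"
  unfolding bilinear_def semidirect_bracket_def linear_iff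
  using assms
  by (auto simp: bilinear_ladd bilinear_radd bilinear_lmul bilinear_rmul linear_add linear_cmul
      algebra_simps)

lemma bilinear_alternating_antisym:
  assumes "bilinear br" "\<And>x. br x x = 0"
  shows "br y x = - br x y"
proof -
  have "br x x + br y x + (br x y + br y y) = br (x + y) (x + y)"
    by (simp only: bilinear_ladd[OF assms(1)] bilinear_radd[OF assms(1)])
  then have "br y x + br x y = 0" by (simp add: assms(2))
  then show ?thesis by (simp add: eq_neg_iff_add_eq_0)
qed

lemma lie_algebra_semidirect_bracket:
  fixes br :: "'g::real_vector \<Rightarrow> 'g \<Rightarrow> 'g"
  assumes br: "lie_algebra br" and E: "derivation br E"
  shows "lie_algebra (semidirect_bracket br E)"
proof -
  have fin: "\<exists>B. finite B \<and> span B = (UNIV :: 'g set)" and bil: "bilinear br"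
    and alt: "br x x = 0" and jac: "br x (br y z) + br y (br z x) + br z (br x y) = 0" for x y z
    using br by (auto simp: lie_algebra_def)
  have lin: "linear E" and der: "E (br x y) = br (E x) y + br x (E y)" for x y
    using E by (auto simp: derivation_def)
  note anti = bilinear_alternating_antisym[OF bil alt]
  have "semidirect_bracket br E u (semidirect_bracket br E v w)
      + semidirect_bracket br E v (semidirect_bracket br E w u)
      + semidirect_bracket br E w (semidirect_bracket br E u v) = 0" for u v w
  proof -
    obtain x a y b z c where uvw: "u = (x, a)" "v = (y, b)" "w = (z, c)" by (metis surj_pair)
    \<comment> \<open>The terms without \<open>E\<close> are the Jacobi identity of \<open>br\<close>; those with \<open>E\<close> cancel by the
      Leibniz rule once the arguments are swapped.\<close>
    have "br z (br x y) = - br x (br y z) - br y (br z x)"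
      using jac[of x y z] by (simp add: algebra_simps eq_neg_iff_add_eq_0)
    then show ?thesis
      using anti[of "E z" x] anti[of "E x" y] anti[of "E y" z]
        anti[of "E z" y] anti[of "E x" z] anti[of "E y" x]
      by (simp add: uvw semidirect_bracket_def zero_prod_def bilinear_radd[OF bil]
          bilinear_rsub[OF bil] bilinear_rmul[OF bil] linear_add[OF lin] linear_diff[OF lin]
          linear_cmul[OF lin] der scaleR_add_right scaleR_diff_right mult.commute)
  qed
  moreover have "semidirect_bracket br E u u = 0" for u
    by (simp add: semidirect_bracket_def alt zero_prod_def)
  ultimately show ?thesis
    unfolding lie_algebra_def
    using finite_span_times_real[OF fin] bilinear_semidirect_bracket[OF bil lin] by blast
qed

lemma lower_central_image:
  assumes f: "linear f" and hom: "\<And>x y. f (br x y) = br' (f x) (f y)"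
  shows "lower_central br' (f ` S) k = f ` lower_central br S k"
proof (induction k)
  case (Suc k)
  have "{br' x y | x y. x \<in> f ` S \<and> y \<in> f ` lower_central br S k}
      = f ` {br x y | x y. x \<in> S \<and> y \<in> lower_central br S k}"
    by (auto simp: image_iff) (metis hom)+
  then show ?case by (simp add: Suc linear_span_image[OF f])
qed simp

lemma lie_nilpotent_image:
  assumes f: "linear f" and hom: "\<And>x y. f (br x y) = br' (f x) (f y)" and nil: "lie_nilpotent br S"
  shows "lie_nilpotent br' (f ` S)"
proof -
  obtain k where "lower_central br S k = {0}" using nil by (auto simp: lie_nilpotent_def)
  then have "lower_central br' (f ` S) k = {0}"
    using lower_central_image[where f = f and br = br and br' = br', OF f hom, of S k]
    by (simp add: linear_0[OF f])
  then show ?thesis unfolding lie_nilpotent_def by blast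
qed

text \<open>
  The lower central series of the extension projects onto that of the base, so it reaches the kernel,
  which is central, and vanishes one step later.
\<close>

lemma lie_nilpotent_central_extension:
  assumes ext: "central_extension brE brA p" and nil: "lie_nilpotent brA UNIV"
  shows "lie_nilpotent brE UNIV"
proof -
  have p: "linear p" "surj p" "\<And>u v. p (brE u v) = brA (p u) (p v)"
    "{u. p u = 0} \<subseteq> lie_center brE UNIV" "lie_algebra brE"
    using ext by (auto simp: central_extension_def)
  obtain k where "lower_central brA UNIV k = {0}" using nil by (auto simp: lie_nilpotent_def)
  then have "p ` lower_central brE UNIV k = {0}"
    using lower_central_image[of p brE brA UNIV k] p(1-3) by simp
  then have "lower_central brE UNIV k \<subseteq> lie_center brE UNIV" using p(4) by auto
  then have "brE y x = 0" if "y \<in> lower_central brE UNIV k" for x y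
    using that by (auto simp: lie_center_def)
  moreover have "brE x y = - brE y x" for x y
    by (rule bilinear_alternating_antisym) (use p(5) in \<open>auto simp: lie_algebra_def\<close>)
  ultimately have "brE x y = 0" if "y \<in> lower_central brE UNIV k" for x y
    using that by (metis minus_zero)
  then have "{brE x y | x y. x \<in> UNIV \<and> y \<in> lower_central brE UNIV k} \<subseteq> {0}" by blast
  then have "lower_central brE UNIV (Suc k) \<subseteq> {0}" by (simp add: span_minimal)
  moreover have "0 \<in> lower_central brE UNIV (Suc k)" by (simp add: span_zero)
  ultimately have "lower_central brE UNIV (Suc k) = {0}" by blast
  then show ?thesis unfolding lie_nilpotent_def by blast
qed

lemma pseudo_metric_tilde:
  fixes g :: "'a::real_vector ext \<Rightarrow> 'a ext \<Rightarrow> real"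
  assumes g: "pseudo_metric g" and \<tau>: "\<tau> \<noteq> 0"
  shows "pseudo_metric (metric_tilde g \<tau>)"
proof -
  have bil: "bilinear g" and sym: "g x y = g y x"
    and nondeg: "(\<forall>y. g x y = 0) \<Longrightarrow> x = 0" for x y
    using g unfolding pseudo_metric_def by blast+
  have "bilinear (metric_tilde g \<tau>)"
    unfolding bilinear_def linear_iff metric_tilde_def
    by (simp add: bilinear_ladd[OF bil] bilinear_radd[OF bil] bilinear_lmul[OF bil]
        bilinear_rmul[OF bil] algebra_simps)
  moreover have "u = 0" if u: "\<forall>v. metric_tilde g \<tau> u v = 0" for u
  proof (rule prod_eqI)
    have "g (fst u) y = 0" for y
      using u[rule_format, of "(y, 0)"] by (simp add: metric_tilde_def)
    then show "fst u = fst 0" using nondeg by simp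
    show "snd u = snd 0"
      using u[rule_format, of "(0, 1)"] \<tau> by (simp add: metric_tilde_def bilinear_rzero[OF bil])
  qed
  ultimately show ?thesis using sym by (simp add: pseudo_metric_def metric_tilde_def mult.commute)
qed

section \<open>The Sasaki structure in coordinates\<close>

lemma metric_ext_coords:
  fixes g :: "'a::real_vector ext \<Rightarrow> 'a ext \<Rightarrow> real"
  assumes metric: "pseudo_metric g"
    and g_base: "\<And>x y. g (base x) (base y) = gc x y"
    and g_base_b: "\<And>x. g (base x) b_vec = 0"
    and g_base_xi: "\<And>x. g (base x) xi_vec = 0"
    and g_xi_xi: "g xi_vec xi_vec = 1"
    and g_b_b: "g b_vec b_vec = \<tau>"
    and g_b_xi: "g b_vec xi_vec = 0"
  shows "g (x, s, t) (y, s', t') = gc x y + \<tau> * (s * s') + t * t'"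
proof -
  have bil: "bilinear g" and sym: "g u v = g v u" for u v
    using metric unfolding pseudo_metric_def by blast+
  have dec: "(z, p, q) = base z + p *\<^sub>R b_vec + q *\<^sub>R xi_vec" for z :: 'a and p q
    by (simp add: base_def b_vec_def xi_vec_def)
  have zero: "g b_vec (base z) = 0" "g xi_vec (base z) = 0" "g xi_vec b_vec = 0" for z
    using sym g_base_b g_base_xi g_b_xi by auto
  show ?thesis
    unfolding dec
    by (simp add: bilinear_ladd[OF bil] bilinear_radd[OF bil] bilinear_lmul[OF bil]
        bilinear_rmul[OF bil] assms(2-) zero)
qed

text \<open>
  The bracket of the extension is recovered from its projection and its pairings with \<open>b\<close> and \<open>\<xi>\<close>,
  which are minus the given differentials.  The factor \<open>\<tau>\<close> appears because \<open>g(b, b) = \<tau> = \<tau>\<^sup>-\<^sup>1\<close>.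
\<close>

lemma bracket_ext_coords:
  fixes g :: "'a::real_vector ext \<Rightarrow> 'a ext \<Rightarrow> real"
  assumes gc: "bilinear gc" and \<tau>: "\<tau> * \<tau> = 1"
    and g: "\<And>x s t y s' t'. g (x, s, t) (y, s', t') = gc x y + \<tau> * (s * s') + t * t'"
    and hom: "\<And>u v. fst (brg u v) = brc (fst u) (fst v)"
    and d_xi: "ce_d1 brg (flat g xi_vec) = pullback2 fst (\<lambda>x y. 2 * \<omega> x y)"
    and d_b: "ce_d1 brg (flat g b_vec) = pullback2 fst (act2 D \<omega>)"
  shows "brg (x, s, t) (y, s', t') = (brc x y, \<tau> * (\<omega> (D x) y + \<omega> x (D y)), - 2 * \<omega> x y)"
proof -
  let ?w = "brg (x, s, t) (y, s', t')"
  obtain w p q where w: "?w = (w, p, q)" by (metis surj_pair)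
  have "w = brc x y" using hom[of "(x, s, t)" "(y, s', t')"] w by simp
  moreover have "- q = 2 * \<omega> x y"
    using fun_cong[OF fun_cong[OF d_xi, of "(x, s, t)"], of "(y, s', t')"]
    by (simp add: ce_d1_def flat_def pullback2_def w xi_vec_def g bilinear_lzero[OF gc])
  moreover have "\<tau> * p = \<omega> (D x) y + \<omega> x (D y)"
    using fun_cong[OF fun_cong[OF d_b, of "(x, s, t)"], of "(y, s', t')"]
    by (simp add: ce_d1_def flat_def pullback2_def w b_vec_def g bilinear_lzero[OF gc] act2_def)
  then have "\<tau> * \<tau> * p = \<tau> * (\<omega> (D x) y + \<omega> x (D y))" by (simp only: mult.assoc)
  ultimately show ?thesis by (simp add: w \<tau>)
qed

text \<open>
  Applying \<open>D\<close> twice to \<open>\<omega>\<close> gives \<open>-h\<close> times applying it once.  As \<open>D\<close> commutes with \<open>J\<close>, every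
  occurrence of \<open>D\<close> in the second argument moves to \<open>D\<^sup>*\<close> in the first, and the condition on the
  symmetric and skew parts becomes exactly this identity.
\<close>

lemma twice_derived_kaehler_form:
  fixes gc :: "'a::real_vector \<Rightarrow> 'a \<Rightarrow> real"
  assumes fin: "\<exists>B. finite B \<and> span B = (UNIV :: 'a set)"
    and gc: "pseudo_metric gc" and D: "linear D"
    and \<omega>: "\<And>x y. \<omega> x y = gc x (J y)" and JD: "\<And>x. J (D x) = D (J x)"
    and sym_skew: "commutator (sym_part gc D) (skew_part gc D)
      = (\<lambda>x. h *\<^sub>R sym_part gc D x - 2 *\<^sub>R sym_part gc D (sym_part gc D x))"
  shows "h * (\<omega> (D x) y + \<omega> x (D y)) = \<omega> (D (D x)) y + 2 * \<omega> (D x) (D y) + \<omega> x (D (D y))"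
proof -
  have bil: "bilinear gc" using gc by (simp add: pseudo_metric_def)
  have move: "\<omega> z (D y) = \<omega> (metric_adjoint gc D z) y" for z y
    by (simp add: \<omega> JD metric_adjoint[OF fin gc D])
  have "\<omega> (h *\<^sub>R (D x + metric_adjoint gc D x)) y = \<omega> (D (D x) + 2 *\<^sub>R metric_adjoint gc D (D x)
      + metric_adjoint gc D (metric_adjoint gc D x)) y"
    by (simp only: sym_skew_condition_expanded[OF fin gc D sym_skew])
  then show ?thesis
    unfolding move by (simp add: \<omega> bilinear_ladd[OF bil] bilinear_lmul[OF bil])
qed

text \<open>
  Write \<open>\<beta> = \<omega>(D \<cdot>, \<cdot>) + \<omega>(\<cdot>, D \<cdot>)\<close>, so that \<open>\<tau> \<beta>\<close> and \<open>-2 \<omega>\<close> are the cocycles along \<open>b\<close> and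
  \<open>\<xi>\<close>.  The Leibniz rule along \<open>\<xi>\<close> reads \<open>-2 \<tau> (\<tau> \<beta>) = -2 \<beta>\<close>, which explains the coefficient of
  \<open>\<xi>\<close> in \<open>[e\<^sub>0, b]\<close>; along \<open>b\<close> it reads \<open>h \<beta> = \<beta>(D \<cdot>, \<cdot>) + \<beta>(\<cdot>, D \<cdot>)\<close>.
\<close>

lemma derivation_e0_action:
  assumes D: "derivation brc D" and \<tau>: "\<tau> * \<tau> = 1"
    and brg: "\<And>x s t y s' t'. brg (x, s, t) (y, s', t')
      = (brc x y, \<tau> * (\<omega> (D x) y + \<omega> x (D y)), - 2 * \<omega> x y)"
    and twice: "\<And>x y. h * (\<omega> (D x) y + \<omega> x (D y))
      = \<omega> (D (D x)) y + 2 * \<omega> (D x) (D y) + \<omega> x (D (D y))"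
  shows "derivation brg (e0_action D h \<tau>)"
proof -
  have lin: "linear D" and der: "D (brc x y) = brc (D x) y + brc x (D y)" for x y
    using D by (auto simp: derivation_def)
  have E: "e0_action D h \<tau> (x, s, t) = (D x, s * h, - (2 * \<tau> * s))" for x s t
    by (simp add: e0_action_def base_def b_vec_def xi_vec_def)
  have "linear (e0_action D h \<tau>)"
    unfolding linear_iff split_paired_all
    by (simp add: E linear_add[OF lin] linear_cmul[OF lin] algebra_simps)
  moreover have "e0_action D h \<tau> (brg u v) = brg (e0_action D h \<tau> u) v + brg u (e0_action D h \<tau> v)"
    for u v
  proof -
    obtain x s t y s' t' where uv: "u = (x, s, t)" "v = (y, s', t')" by (metis surj_pair)
    have "\<tau> * (\<omega> (D x) y + \<omega> x (D y)) * h
        = \<tau> * (\<omega> (D (D x)) y + 2 * \<omega> (D x) (D y) + \<omega> x (D (D y)))"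
      using twice[of x y] by (simp add: mult.assoc mult.commute[of _ h])
    moreover have "2 * \<tau> * (\<tau> * (\<omega> (D x) y + \<omega> x (D y))) = 2 * (\<omega> (D x) y + \<omega> x (D y))"
      by (simp only: mult.assoc[symmetric] mult.assoc[of 2 \<tau> \<tau>] \<tau> mult_1_right)
    ultimately show ?thesis by (simp add: uv brg E der algebra_simps)
  qed
  ultimately show ?thesis by (simp add: derivation_def)
qed

lemma phi_tilde_coords:
  assumes gc: "bilinear gc" and \<tau>: "\<tau> * \<tau> = 1"
    and g: "\<And>x s t y s' t'. g (x, s, t) (y, s', t') = gc x y + \<tau> * (s * s') + t * t'"
  shows "phi_tilde J g \<tau> ((x, s, t), r) = ((J x, - r, 0), s)"
  using \<tau>
  by (simp add: phi_tilde_def in_tilde_def J_ext_def base_def e0_vec_def b_vec_def g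
      bilinear_lzero[OF gc] mult.assoc[symmetric])

lemma almost_contact_metric_tilde:
  fixes g :: "'a::real_vector ext \<Rightarrow> 'a ext \<Rightarrow> real"
  assumes fin: "\<exists>B. finite B \<and> span B = (UNIV :: ('a ext) set)"
    and metric: "pseudo_metric g" and gc: "bilinear gc" and \<tau>: "\<tau> * \<tau> = 1"
    and g: "\<And>x s t y s' t'. g (x, s, t) (y, s', t') = gc x y + \<tau> * (s * s') + t * t'"
    and J: "linear J" "\<And>x. J (J x) = - x" "\<And>x y. gc (J x) (J y) = gc x y"
  shows "almost_contact_metric (phi_tilde J g \<tau>) (in_tilde xi_vec) (\<lambda>u. flat g xi_vec (fst u))
    (metric_tilde g \<tau>)"
proof -
  note \<phi> = phi_tilde_coords[OF gc \<tau> g]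
  have \<eta>: "flat g xi_vec (x, s, t) = t" for x s t
    by (simp add: flat_def xi_vec_def g bilinear_lzero[OF gc])
  have \<xi>: "in_tilde xi_vec = ((0, 0, 1), 0)" by (simp add: in_tilde_def xi_vec_def)
  have "linear (phi_tilde J g \<tau>)"
    unfolding linear_iff split_paired_all
    by (simp add: \<phi> linear_add[OF J(1)] linear_cmul[OF J(1)])
  moreover have "linear (\<lambda>u. flat g xi_vec (fst u))"
    unfolding linear_iff split_paired_all by (simp add: \<eta>)
  moreover have "flat g xi_vec (fst (in_tilde xi_vec :: 'a ext \<times> real)) = 1"
    by (simp add: \<xi> \<eta>)
  moreover have "flat g xi_vec (fst (phi_tilde J g \<tau> u)) = 0" for u
    by (cases u) (auto simp: \<phi> \<eta>)
  moreover have "phi_tilde J g \<tau> (phi_tilde J g \<tau> u)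
      = - u + flat g xi_vec (fst u) *\<^sub>R in_tilde xi_vec" for u
    by (cases u) (auto simp: \<phi> \<eta> J(2) \<xi>)
  moreover have "metric_tilde g \<tau> (phi_tilde J g \<tau> u) (phi_tilde J g \<tau> v)
      = metric_tilde g \<tau> u v - flat g xi_vec (fst u) * flat g xi_vec (fst v)" for u v
    by (cases u; cases v) (auto simp: \<phi> \<eta> J(3) g metric_tilde_def)
  moreover have "metric_tilde g \<tau> (in_tilde xi_vec) (in_tilde xi_vec) = 1"
    "\<And>u. flat g xi_vec (fst u) = metric_tilde g \<tau> (in_tilde xi_vec) u"
    by (simp_all add: metric_tilde_def in_tilde_def flat_def xi_vec_def g bilinear_lzero[OF gc])
  moreover have "pseudo_metric (metric_tilde g \<tau>)"
    by (rule pseudo_metric_tilde[OF metric]) (use \<tau> in auto)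
  ultimately show ?thesis
    unfolding almost_contact_metric_def
    using almost_contact_odd_dimension[OF finite_span_times_real[OF fin]] by blast
qed

text \<open>
  Since \<open>\<phi>\<^sup>2 w + d\<eta>(u, v) \<xi> = - w\<close> for \<open>w = [u, v]\<close>, the condition says
  \<open>[\<phi> u, \<phi> v] = [u, v] + \<phi> [\<phi> u, v] + \<phi> [u, \<phi> v]\<close>.  Its component in the base reduces to the
  vanishing of the Nijenhuis tensor of \<open>J\<close> and to \<open>[J, D] = 0\<close>; the other components reduce to the
  \<open>J\<close>-invariance of \<open>\<omega>\<close> and of \<open>\<omega>(D \<cdot>, \<cdot>) + \<omega>(\<cdot>, D \<cdot>)\<close>, which again uses \<open>[J, D] = 0\<close>.
\<close>

lemma normal_tilde:
  fixes h :: real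
  assumes brc: "bilinear brc" and gc: "bilinear gc" and D: "linear D" and \<tau>: "\<tau> * \<tau> = 1"
    and g: "\<And>x s t y s' t'. g (x, s, t) (y, s', t') = gc x y + \<tau> * (s * s') + t * t'"
    and J: "linear J" "\<And>x. J (J x) = - x" "\<And>x y. gc (J x) (J y) = gc x y"
    and N: "\<And>x y. nijenhuis brc J x y = 0"
    and \<omega>: "\<And>x y. \<omega> x y = gc x (J y)" and JD: "\<And>x. J (D x) = D (J x)"
    and brg: "\<And>x s t y s' t'. brg (x, s, t) (y, s', t')
      = (brc x y, \<tau> * (\<omega> (D x) y + \<omega> x (D y)), - 2 * \<omega> x y)"
  defines "brt \<equiv> semidirect_bracket brg (e0_action D h \<tau>)"
  shows "nijenhuis brt (phi_tilde J g \<tau>) u v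
    + ce_d1 brt (\<lambda>u. flat g xi_vec (fst u)) u v *\<^sub>R in_tilde xi_vec = 0"
proof -
  obtain x s t r y s' t' r' where uv: "u = ((x, s, t), r)" "v = ((y, s', t'), r')"
    by (metis surj_pair)
  note \<phi> = phi_tilde_coords[OF gc \<tau> g]
  have \<eta>: "flat g xi_vec (x, s, t) = t" for x s t
    by (simp add: flat_def xi_vec_def g bilinear_lzero[OF gc])
  have \<xi>: "in_tilde xi_vec = ((0, 0, 1), 0)" by (simp add: in_tilde_def xi_vec_def)
  define \<beta> where "\<beta> x y = \<omega> (D x) y + \<omega> x (D y)" for x y
  have brt: "brt ((x, s, t), r) ((y, s', t'), r') = ((brc x y + r *\<^sub>R D y - r' *\<^sub>R D x,
      \<tau> * \<beta> x y + h * (r * s' - r' * s), - 2 * \<omega> x y - 2 * \<tau> * (r * s' - r' * s)), 0)"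
    for x s t r y s' t' r'
    by (simp add: brt_def semidirect_bracket_def brg e0_action_def base_def b_vec_def xi_vec_def
        \<beta>_def algebra_simps)
  have \<omega>J: "\<omega> (J x) (J y) = \<omega> x y" for x y by (simp add: \<omega> J(3))
  have \<beta>J: "\<beta> (J x) (J y) = \<beta> x y" for x y
    by (simp add: \<beta>_def \<omega> J(3) flip: JD)
  have \<beta>neg: "\<beta> x (- y) = - \<beta> x y" "\<beta> (- x) y = - \<beta> x y" for x y
    by (simp_all add: \<beta>_def \<omega> linear_neg[OF D] linear_neg[OF J(1)] bilinear_rneg[OF gc]
        bilinear_lneg[OF gc])
  have \<beta>J': "\<beta> x (J y) = - \<beta> (J x) y" for x y
    using \<beta>J[of x "J y"] by (simp add: J(2) \<beta>neg)
  have base: "brc (J x) (J y) = brc x y + J (brc (J x) y) + J (brc x (J y))"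
    using N[of x y] by (simp add: nijenhuis_def J(2) algebra_simps)
  show ?thesis
    unfolding uv nijenhuis_def ce_d1_def
    by (simp add: brt \<phi> \<eta> \<xi> zero_prod_def base J(2) \<omega>J \<beta>J \<beta>J' \<beta>neg
        linear_add[OF J(1)] linear_diff[OF J(1)] linear_cmul[OF J(1)] linear_neg[OF J(1)]
        JD[symmetric] algebra_simps)
qed

lemma contact_form_tilde:
  assumes gc: "bilinear gc" and \<tau>: "\<tau> * \<tau> = 1"
    and g: "\<And>x s t y s' t'. g (x, s, t) (y, s', t') = gc x y + \<tau> * (s * s') + t * t'"
    and \<omega>: "\<And>x y. \<omega> x y = gc x (J y)"
    and brg: "\<And>x s t y s' t'. brg (x, s, t) (y, s', t')
      = (brc x y, \<tau> * (\<omega> (D x) y + \<omega> x (D y)), - 2 * \<omega> x y)"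
  shows "ce_d1 (semidirect_bracket brg (e0_action D h \<tau>)) (\<lambda>u. flat g xi_vec (fst u)) u v
    = 2 * metric_tilde g \<tau> u (phi_tilde J g \<tau> v)"
proof -
  obtain x s t r y s' t' r' where uv: "u = ((x, s, t), r)" "v = ((y, s', t'), r')"
    by (metis surj_pair)
  have \<eta>: "flat g xi_vec (x, s, t) = t" for x s t
    by (simp add: flat_def xi_vec_def g bilinear_lzero[OF gc])
  have E: "e0_action D h \<tau> (x, s, t) = (D x, s * h, - (2 * \<tau> * s))" for x s t
    by (simp add: e0_action_def base_def b_vec_def xi_vec_def)
  show ?thesis
    by (simp add: uv ce_d1_def \<eta> semidirect_bracket_def brg E metric_tilde_def
        phi_tilde_coords[OF gc \<tau> g] g \<omega> algebra_simps)
qed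

theorem proposition5p1:
  fixes brc :: "'a::real_vector \<Rightarrow> 'a \<Rightarrow> 'a"
    and gc \<omega> :: "'a \<Rightarrow> 'a \<Rightarrow> real"
    and J D :: "'a \<Rightarrow> 'a"
    and \<tau> h :: real
    and brg :: "'a ext \<Rightarrow> 'a ext \<Rightarrow> 'a ext"
    and g :: "'a ext \<Rightarrow> 'a ext \<Rightarrow> real"
  defines "brt \<equiv> semidirect_bracket brg (e0_action D h \<tau>)"
    and "gt \<equiv> metric_tilde g \<tau>"
    and "\<phi> \<equiv> phi_tilde J g \<tau>"
    and "\<xi> \<equiv> in_tilde (xi_vec :: 'a ext)"
    and "\<eta> \<equiv> (\<lambda>u :: 'a ext \<times> real. flat g xi_vec (fst u))"
  assumes kaehler: "pseudo_kaehler brc gc J \<omega>"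
    and nilpotent: "lie_nilpotent brc UNIV"
    and deriv: "derivation brc D"
    and tau: "\<tau> = 1 \<or> \<tau> = -1"
    and central: "central_extension brg brc fst"
    and metric: "pseudo_metric g"
    and g_base: "\<And>x y. g (base x) (base y) = gc x y"
    and g_base_b: "\<And>x. g (base x) b_vec = 0"
    and g_base_xi: "\<And>x. g (base x) xi_vec = 0"
    and g_xi_xi: "g xi_vec xi_vec = 1"
    and g_b_b: "g b_vec b_vec = \<tau>"
    and g_b_xi: "g b_vec xi_vec = 0"
    and d_xi: "ce_d1 brg (flat g xi_vec) = pullback2 fst (\<lambda>x y. 2 * \<omega> x y)"
    and d_b: "ce_d1 brg (flat g b_vec) = pullback2 fst (act2 D \<omega>)"
    and J_D: "commutator J D = (\<lambda>x. 0)"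
    and sym_skew: "commutator (sym_part gc D) (skew_part gc D)
      = (\<lambda>x. h *\<^sub>R sym_part gc D x - 2 *\<^sub>R sym_part gc D (sym_part gc D x))"
  shows "z_standard_sasaki brt \<phi> \<xi> \<eta> gt \<and>
    z_standard_decomposition brt \<phi> gt (range in_tilde) e0_vec \<tau>"
proof -
  note kaehler_facts = kaehler[unfolded pseudo_kaehler_def]
  have fin: "\<exists>B. finite B \<and> span B = (UNIV :: 'a set)" and brc: "bilinear brc"
    using kaehler_facts unfolding lie_algebra_def by blast+
  have gc: "pseudo_metric gc" "bilinear gc"
    using kaehler_facts unfolding pseudo_metric_def by blast+
  have J: "linear J" "\<And>x. J (J x) = - x" "\<And>x y. gc (J x) (J y) = gc x y"
    and N: "\<And>x y. nijenhuis brc J x y = 0" and \<omega>: "\<And>x y. \<omega> x y = gc x (J y)"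
    using kaehler_facts by blast+
  have D: "linear D" using deriv by (simp add: derivation_def)
  have JD: "J (D x) = D (J x)" for x using fun_cong[OF J_D, of x] by (simp add: commutator_def)
  have \<tau>: "\<tau> * \<tau> = 1" using tau by auto
  have lie_g: "lie_algebra brg" and hom: "\<And>u v. fst (brg u v) = brc (fst u) (fst v)"
    and center: "{u. fst u = 0} \<subseteq> lie_center brg UNIV"
    using central unfolding central_extension_def by blast+
  have fin_g: "\<exists>B. finite B \<and> span B = (UNIV :: ('a ext) set)"
    using lie_g unfolding lie_algebra_def by blast
  note g = metric_ext_coords[OF metric g_base g_base_b g_base_xi g_xi_xi g_b_b g_b_xi]
  note brg = bracket_ext_coords[OF gc(2) \<tau> g hom d_xi d_b]
  have twice: "h * (\<omega> (D x) y + \<omega> x (D y)) = \<omega> (D (D x)) y + 2 * \<omega> (D x) (D y) + \<omega> x (D (D y))"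
    for x y
    by (rule twice_derived_kaehler_form[where gc = gc and J = J]) (fact fin gc(1) D \<omega> JD sym_skew)+
  have der_E: "derivation brg (e0_action D h \<tau>)"
    by (rule derivation_e0_action[where brg = brg]) (fact deriv \<tau> brg twice)+
  have "sasaki brt \<phi> \<xi> \<eta> gt"
    unfolding sasaki_def brt_def gt_def \<phi>_def \<xi>_def \<eta>_def
  proof (intro conjI allI)
    show "lie_algebra (semidirect_bracket brg (e0_action D h \<tau>))"
      by (rule lie_algebra_semidirect_bracket[OF lie_g der_E])
    show "almost_contact_metric (phi_tilde J g \<tau>) (in_tilde xi_vec)
        (\<lambda>u. flat g xi_vec (fst u)) (metric_tilde g \<tau>)"
      by (rule almost_contact_metric_tilde) (fact fin_g metric gc(2) \<tau> g J)+
    show "ce_d1 (semidirect_bracket brg (e0_action D h \<tau>)) (\<lambda>u. flat g xi_vec (fst u)) u v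
        = 2 * metric_tilde g \<tau> u (phi_tilde J g \<tau> v)" for u v
      by (rule contact_form_tilde) (fact gc(2) \<tau> g \<omega> brg)+
    show "nijenhuis (semidirect_bracket brg (e0_action D h \<tau>)) (phi_tilde J g \<tau>) u v
        + ce_d1 (semidirect_bracket brg (e0_action D h \<tau>)) (\<lambda>u. flat g xi_vec (fst u)) u v
          *\<^sub>R in_tilde xi_vec = 0" for u v
      by (rule normal_tilde) (fact brc gc(2) D \<tau> g J N \<omega> JD brg)+
  qed
  moreover have "z_standard_decomposition brt \<phi> gt (range in_tilde) e0_vec \<tau>"
  proof -
    have in_tilde: "linear (in_tilde :: 'a ext \<Rightarrow> _)"
      by (rule linearI) (auto simp: in_tilde_def)
    have in_tilde_hom: "in_tilde (brg x y) = brt (in_tilde x) (in_tilde y)" for x y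
      by (simp add: in_tilde_def brt_def semidirect_bracket_def)
    have range: "range (in_tilde :: 'a ext \<Rightarrow> _) = {u. snd u = 0}"
      by (auto simp: in_tilde_def image_iff)
    have "lie_nilpotent brt (range in_tilde)"
      by (rule lie_nilpotent_image[OF in_tilde in_tilde_hom
            lie_nilpotent_central_extension[OF central nilpotent]])
    moreover have "lie_ideal brt (range in_tilde)"
      unfolding range by (auto simp: lie_ideal_def brt_def semidirect_bracket_def subspace_def)
    moreover have "\<exists>x\<in>range in_tilde. \<exists>r. u = x + r *\<^sub>R e0_vec" for u :: "'a ext \<times> real"
      by (cases u) (auto simp: in_tilde_def e0_vec_def)
    moreover have "- \<phi> e0_vec = in_tilde b_vec"
      by (simp add: \<phi>_def e0_vec_def zero_prod_def phi_tilde_coords[OF gc(2) \<tau> g]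
          linear_0[OF J(1)] in_tilde_def b_vec_def)
    moreover have "in_tilde b_vec \<in> lie_center brt (range in_tilde)"
    proof -
      have "b_vec \<in> lie_center brg UNIV" using center by (auto simp: b_vec_def)
      then have "brg b_vec x = 0" for x unfolding lie_center_def by blast
      then have "brt (in_tilde b_vec) (in_tilde x) = 0" for x
        by (simp add: in_tilde_hom[symmetric] linear_0[OF in_tilde])
      then show ?thesis by (auto simp: lie_center_def)
    qed
    moreover have "bilinear g" using metric by (simp add: pseudo_metric_def)
    then have "\<forall>x\<in>range in_tilde. gt x e0_vec = 0" "gt e0_vec e0_vec = \<tau>"
      by (auto simp: gt_def metric_tilde_def in_tilde_def e0_vec_def bilinear_rzero)
    moreover have "e0_vec \<notin> range (in_tilde :: 'a ext \<Rightarrow> _)" by (auto simp: range e0_vec_def)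
    ultimately show ?thesis unfolding z_standard_decomposition_def using tau by simp
  qed
  ultimately show ?thesis unfolding z_standard_sasaki_def by blast
qed

end
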